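(* Let $n\in\mathbb{N}$ and $2\leqslant p<\infty$. Then the metric space $(\mathbb{P}^n,d_p)$, where $\mathbb{P}^n=\mathbb{R}^n\times\mathbb{R}$ and $d_p((x_1,t_1),(x_2,t_2))=(|x_1-x_2|^p+|t_1-t_2|^{p/2})^{1/p}$, satisfies the strong Besicovitch Covering Property (s-BCP).
   Context: $|x|$ denotes the Euclidean norm of $x\in\mathbb{R}^n$. In a metric space $(X,d)$, $B_r(x)$ denotes the closed ball with center $x$ and radius $r>0$. A metric space $(X,d)$ satisfies the strong Besicovitch Covering Property (s-BCP) if Besicovitch's covering theorem holds on it, that is: there exist constants $M_1,M_2\in\mathbb{N}$ (depending only on the metric space) with the following property. Let $A$ be a bounded subset of $X$ and let $\mathcal{B}$ be a family of closed balls such that each point of $A$ is the center of a ball of $\mathcal{B}$. Then there is a subfamily $\mathcal{B}'\subset\mathcal{B}$ such that $A\subset\bigcup_{B\in\mathcal{B}'}B$ and $\sum_{B\in\mathcal{B}'}\chi_{B}(y)\leqslant M_1$ for every $y\in X$ (where $\chi_B$ is the indicator function of $B$). Moreover, the family $\mathcal{B}'$ can be split into $M_2$ disjoint subfamilies, meaning subfamilies each of which consists of pairwise disjoint balls (some subfamilies may be empty). *)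

theory Defs
  imports "HOL-Analysis.Analysis"
begin

context Metric_space
begin

definition closed_balls :: "'a set set" where
  "closed_balls = {mcball x r | x r. x \<in> M \<and> r > 0}"

text \<open>The overlap sum is taken in \<^typ>\<open>ennreal\<close>, so that a point lying in infinitely many
  balls has overlap \<open>\<infinity>\<close>; a finite or real-valued sum would be \<open>0\<close> there by convention.\<close>

definition strong_BCP :: bool where
  "strong_BCP \<longleftrightarrow>
    (\<exists>M1 M2 :: nat. \<forall>A \<B>.
      A \<subseteq> M \<and> mbounded A \<and> \<B> \<subseteq> closed_balls \<and> (\<forall>a\<in>A. \<exists>r>0. mcball a r \<in> \<B>) \<longrightarrow>
      (\<exists>\<B>'\<subseteq>\<B>.
        A \<subseteq> \<Union>\<B>' \<and>
        (\<forall>y\<in>M. (\<Sum>\<^sub>\<infinity>B\<in>\<B>'. indicator B y :: ennreal) \<le> of_nat M1) \<and>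
        (\<exists>\<F> :: nat \<Rightarrow> 'a set set.
          \<B>' = (\<Union>i<M2. \<F> i) \<and> disjoint_family_on \<F> {..<M2} \<and>
          (\<forall>i<M2. pairwise disjnt (\<F> i)))))"

end

definition parabolic_dist ::
    "real \<Rightarrow> (real ^ 'n) \<times> real \<Rightarrow> (real ^ 'n) \<times> real \<Rightarrow> real" where
  "parabolic_dist p = (\<lambda>(x1, t1) (x2, t2).
     (norm (x1 - x2) powr p + \<bar>t1 - t2\<bar> powr (p / 2)) powr (1 / p))"

end

theory Submission imports Defs begin

text \<open>
  Besicovitch's greedy choice gives balls whose radii decrease up to a factor \<open>2\<close> and whose centres
  avoid all earlier balls. If each ball meets at most \<open>N\<close> of its predecessors, then \<open>N + 1\<close> colours
  suffice to separate intersecting balls, which gives both the splitting and the bounded overlap.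

  To find \<open>N\<close>, normalise the later ball to the unit ball at the origin by a translation and a parabolic
  dilation. The centres \<open>(x, t)\<close> of the earlier balls that meet it are sorted into finitely many classes,
  by the direction of \<open>x\<close>, the sign of \<open>t\<close>, whether \<open>|x|\<^sup>2 \<le> |t|\<close>, and whether \<open>|x| \<le> 2\<close>. The last
  distinction is essential near the \<open>t\<close>-axis: there the horizontal direction is not determined well
  enough, but then horizontal displacements are bounded and the vertical gain absorbs them. If two centres
  of one class had norms of very different size, then the far one would be at least as close to the near
  one as to any point of the unit ball, so its ball would contain the near centre. Hence the norms in a
  class are comparable, and a separation argument bounds the number of centres.
\<close>

section \<open>Besicovitch coverings by greedy selection\<close>

text \<open>Colour the indices in increasing order: the at most \<open>N\<close> earlier neighbours
  of \<open>k\<close> exclude at most \<open>N\<close> of the \<open>N + 1\<close> colours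
  \<open>0, ..., N\<close>, so one is always free.\<close>

lemma bounded_degree_colouring:
  fixes R :: "nat \<Rightarrow> nat \<Rightarrow> bool"
  assumes "\<And>k. card {i. i < k \<and> R i k} \<le> N"
  obtains col :: "nat \<Rightarrow> nat" where "\<And>k. col k \<le> N" "\<And>i k. i < k \<Longrightarrow> R i k \<Longrightarrow> col i \<noteq> col k"
proof -
  have "\<exists>f::nat \<Rightarrow> nat. \<forall>k. f k \<le> N \<and> (\<forall>i<k. R i k \<longrightarrow> f i \<noteq> f k)"
  proof (rule dependent_wellorder_choice)
    fix k and f :: "nat \<Rightarrow> nat"
    have "card (f ` {i. i < k \<and> R i k}) < card {..N}"
      using card_image_le[of "{i. i < k \<and> R i k}" f] assms[of k] by simp
    then have "\<not> {..N} \<subseteq> f ` {i. i < k \<and> R i k}"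
      using card_mono[of "f ` {i. i < k \<and> R i k}" "{..N}"] by auto
    then obtain m where "m \<in> {..N}" "m \<notin> f ` {i. i < k \<and> R i k}"
      by blast
    then show "\<exists>m. m \<le> N \<and> (\<forall>i<k. R i k \<longrightarrow> f i \<noteq> m)"
      by auto
  qed simp
  then obtain f :: "nat \<Rightarrow> nat" where "\<forall>k. f k \<le> N \<and> (\<forall>i<k. R i k \<longrightarrow> f i \<noteq> f k)" ..
  then show thesis
    by (intro that[of f]) auto
qed

context Metric_space
begin

text \<open>Repeatedly take, among the points not yet covered, a centre of nearly maximal radius. A
  point \<open>a\<close> that is never covered keeps all chosen radii at least
  \<open>rad a / 2\<close>, so the centres form an infinite bounded separated set, which
  \<open>separated\<close> excludes.\<close>

lemma greedy_ball_selection: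
  assumes A: "A \<subseteq> M" "mbounded A"
    and rad: "\<And>a. a \<in> A \<Longrightarrow> rad a > 0" "\<And>a. a \<in> A \<Longrightarrow> rad a \<le> b"
    and separated: "\<And>S \<epsilon>. \<lbrakk>mbounded S; \<epsilon> > 0; pairwise (\<lambda>x y. \<epsilon> \<le> d x y) S\<rbrakk> \<Longrightarrow> finite S"
  shows "\<exists>(c :: nat \<Rightarrow> 'a) J. c ` J \<subseteq> A \<and> A \<subseteq> (\<Union>j\<in>J. mcball (c j) (rad (c j))) \<and>
    (\<forall>i\<in>J. \<forall>j\<in>J. i < j \<longrightarrow> rad (c i) < d (c i) (c j) \<and> rad (c j) \<le> 2 * rad (c i))"
proof -
  \<comment> \<open>The supremum of the radii over \<open>V\<close> is finite and positive, so some
    radius exceeds half of it.\<close>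
  have "\<exists>a\<in>V. \<forall>a'\<in>V. rad a' \<le> 2 * rad a" if V: "V \<subseteq> A" "V \<noteq> {}" for V
  proof -
    have bdd: "bdd_above (rad ` V)"
      using V rad by (intro bdd_aboveI2[where M = b]) auto
    obtain v where v: "v \<in> V"
      using V by blast
    have "0 < rad v"
      using v V rad by auto
    also have "rad v \<le> Sup (rad ` V)"
      using v bdd by (simp add: cSUP_upper)
    finally have "Sup (rad ` V) / 2 < Sup (rad ` V)"
      by simp
    then obtain a where "a \<in> V" "Sup (rad ` V) / 2 < rad a"
      using less_cSUP_iff[OF V(2) bdd] by auto
    moreover have "rad a' \<le> Sup (rad ` V)" if "a' \<in> V" for a'
      using that bdd by (simp add: cSUP_upper)
    ultimately show ?thesis
      by (smt (verit, del_insts) field_sum_of_halves)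
  qed
  then obtain pick where pick: "\<And>V. V \<subseteq> A \<Longrightarrow> V \<noteq> {} \<Longrightarrow> pick V \<in> V \<and> (\<forall>a'\<in>V. rad a' \<le> 2 * rad (pick V))"
    by metis
  \<comment> \<open>\<open>U k\<close> is the part of \<open>A\<close> left uncovered by the first
    \<open>k\<close> balls. The process stops once it is empty, and \<open>J\<close> below collects
    the indices before that; outside \<open>J\<close> the value of \<open>c\<close> is
    arbitrary.\<close>
  define U where "U = rec_nat A (\<lambda>_ V. V - mcball (pick V) (rad (pick V)))"
  have U0: "U 0 = A" and USuc: "U (Suc k) = U k - mcball (pick (U k)) (rad (pick (U k)))" for k
    by (simp_all add: U_def)
  have anti: "U j \<subseteq> U i" if "i \<le> j" for i j
    using that by (induction rule: dec_induct) (auto simp: USuc)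
  have UA: "U k \<subseteq> A" for k
    using anti[of 0 k] by (simp add: U0)
  define c where "c k = pick (U k)" for k
  define J where "J = {k. U k \<noteq> {}}"
  have cU: "c j \<in> U j" if "j \<in> J" for j
    using pick[OF UA] that by (auto simp: c_def J_def)
  have order: "rad (c i) < d (c i) (c j) \<and> rad (c j) \<le> 2 * rad (c i)"
    if "i \<in> J" "j \<in> J" "i < j" for i j
  proof -
    have "c j \<in> U (Suc i)"
      using cU[OF that(2)] anti[of "Suc i" j] that by auto
    then have "c j \<notin> mcball (c i) (rad (c i))" "c j \<in> U i"
      by (auto simp: USuc c_def)
    moreover have "c i \<in> M" "c j \<in> M"
      using cU that UA A by blast+
    ultimately show ?thesis
      using pick[OF UA, of i] that by (auto simp: c_def J_def)
  qed
  have "A \<subseteq> (\<Union>j\<in>J. mcball (c j) (rad (c j)))"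
  proof (rule ccontr)
    assume "\<not> ?thesis"
    then obtain a where a: "a \<in> A" "\<And>j. j \<in> J \<Longrightarrow> a \<notin> mcball (c j) (rad (c j))"
      by blast
    have aU: "a \<in> U k" for k
    proof (induction k)
      case (Suc k)
      then have "k \<in> J"
        by (auto simp: J_def)
      with Suc a(2) show ?case
        by (simp add: USuc c_def)
    qed (simp add: U0 a)
    then have J: "J = UNIV"
      by (auto simp: J_def)
    have cA: "c k \<in> A" for k
      using cU[of k] UA[of k] J by auto
    \<comment> \<open>Since \<open>a\<close> is still available at stage \<open>k\<close>, the
      choice of \<open>c k\<close> competes with it.\<close>
    have low: "rad a / 2 \<le> rad (c k)" for k
      using pick[OF UA, of k] aU[of k] by (force simp: c_def)
    have sep: "rad a / 2 \<le> d (c i) (c j)" if "i \<noteq> j" for i j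
      using that order[of i j] order[of j i] low[of i] low[of j] commute[of "c i" "c j"]
      unfolding J by (cases "i < j") auto
    have "finite (range c)"
    proof (rule separated)
      show "mbounded (range c)"
        using cA by (intro mbounded_subset[OF A(2)]) auto
      show "0 < rad a / 2"
        using rad(1)[OF a(1)] by simp
      show "pairwise (\<lambda>x y. rad a / 2 \<le> d x y) (range c)"
      proof (rule pairwiseI)
        fix x y assume "x \<in> range c" "y \<in> range c" "x \<noteq> y"
        then obtain i j where "x = c i" "y = c j" "i \<noteq> j"
          by auto
        then show "rad a / 2 \<le> d x y"
          using sep by simp
      qed
    qed
    moreover have "inj c"
    proof (rule injI, rule ccontr)
      fix i j assume ij: "c i = c j" "i \<noteq> j"
      have "c j \<in> M"
        using cA A by auto
      then show False
        using sep[OF ij(2)] rad(1)[OF a(1)] ij(1) by simp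
    qed
    ultimately show False
      using finite_imageD[of c UNIV] by simp
  qed
  moreover have "c ` J \<subseteq> A"
    using cU UA by blast
  ultimately show ?thesis
    using order by (intro exI[of _ c] exI[of _ J]) simp
qed

text \<open>Each of the \<open>n\<close> families has at most one ball through \<open>y\<close>, so
  sending such a ball to the index of a family containing it is injective.\<close>

lemma sum_indicator_le_card:
  assumes "\<And>i. i < n \<Longrightarrow> pairwise disjnt (F i)"
  shows "(\<Sum>\<^sub>\<infinity>B\<in>(\<Union>i<n. F i). indicator B y :: ennreal) \<le> of_nat n"
proof -
  define \<C> where "\<C> = {B \<in> (\<Union>i<n. F i). y \<in> B}"
  define col where "col B = (SOME i. i < n \<and> B \<in> F i)" for B
  have col: "col B < n \<and> B \<in> F (col B)" if "B \<in> \<C>" for B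
    using someI_ex[of "\<lambda>i. i < n \<and> B \<in> F i"] that by (auto simp: \<C>_def col_def)
  have inj: "inj_on col \<C>"
  proof (rule inj_onI, rule ccontr)
    fix B C assume *: "B \<in> \<C>" "C \<in> \<C>" "col B = col C" "B \<noteq> C"
    then have "disjnt B C"
      using col[of B] col[of C] assms[of "col B"] by (auto simp: pairwise_def)
    with * show False
      by (auto simp: \<C>_def disjnt_def)
  qed
  have img: "col ` \<C> \<subseteq> {..<n}"
    using col by auto
  have fin: "finite \<C>"
    using inj_on_finite[OF inj img] by simp
  have "(\<Sum>\<^sub>\<infinity>B\<in>(\<Union>i<n. F i). indicator B y :: ennreal) = (\<Sum>\<^sub>\<infinity>B\<in>\<C>. 1)"
    by (rule infsum_cong_neutral) (auto simp: \<C>_def)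
  also have "\<dots> = of_nat (card \<C>)"
    using fin by simp
  also have "\<dots> \<le> of_nat n"
    using card_inj_on_le[OF inj img] by simp
  finally show ?thesis .
qed

text \<open>This leaves two geometric facts to check: finiteness of bounded separated sets, which
  makes the greedy choice exhaust \<open>A\<close>, and a bound \<open>N\<close> on how many earlier
  balls meet a later one \<open>mcball x \<rho>\<close>. Colouring then gives \<open>Suc N\<close>
  for both constants.\<close>

theorem strong_BCP_criterion:
  assumes separated: "\<And>S \<epsilon>. \<lbrakk>mbounded S; \<epsilon> > 0; pairwise (\<lambda>x y. \<epsilon> \<le> d x y) S\<rbrakk> \<Longrightarrow> finite S"
    and overlap: "\<And>(I :: nat set) c r x \<rho>. 
      \<lbrakk>finite I; x \<in> M; \<rho> > 0; c ` I \<subseteq> M;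
       \<And>i. i \<in> I \<Longrightarrow> \<rho> \<le> 2 * r i \<and> r i < d (c i) x \<and> \<not> disjnt (mcball (c i) (r i)) (mcball x \<rho>);
       \<And>i j. \<lbrakk>i \<in> I; j \<in> I; i < j\<rbrakk> \<Longrightarrow> r i < d (c i) (c j) \<and> r j \<le> 2 * r i\<rbrakk> \<Longrightarrow> card I \<le> N"
  shows strong_BCP
  unfolding strong_BCP_def
proof (intro exI[of _ "Suc N"] allI impI, elim conjE)
  fix A \<B>
  assume A: "A \<subseteq> M" "mbounded A" and \<B>: "\<B> \<subseteq> closed_balls" "\<forall>a\<in>A. \<exists>r>0. mcball a r \<in> \<B>"
  obtain rad where rad: "\<And>a. a \<in> A \<Longrightarrow> rad a > 0 \<and> mcball a (rad a) \<in> \<B>"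
    using \<B>(2) by metis
  have rad_pos: "\<And>a. a \<in> A \<Longrightarrow> rad a > 0"
    using rad by blast
  have "\<exists>F. (\<Union>i<Suc N. F i) \<subseteq> \<B> \<and> A \<subseteq> \<Union>(\<Union>i<Suc N. F i) \<and>
          disjoint_family_on F {..<Suc N} \<and> (\<forall>i<Suc N. pairwise disjnt (F i))"
  proof (cases "bdd_above (rad ` A)")
    \<comment> \<open>With unbounded radii, a single ball of radius at least the diameter bound
      covers \<open>A\<close>; all other families are empty.\<close>
    case False
    obtain b where b: "\<And>x y. x \<in> A \<Longrightarrow> y \<in> A \<Longrightarrow> d x y \<le> b"
      using A(2) by (auto simp: mbounded_alt)
    obtain a where "a \<in> A" "b \<le> rad a"
      using False by (meson bdd_aboveI2 linear)
    then have a: "mcball a (rad a) \<in> \<B>" "A \<subseteq> mcball a (rad a)"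
      using rad b A by fastforce+
    define F where "F i = (if i = 0 then {mcball a (rad a)} else {})" for i :: nat
    have "(\<Union>i<Suc N. F i) = {mcball a (rad a)}"
      by (auto simp: F_def)
    moreover have "disjoint_family_on F {..<Suc N}" "\<forall>i<Suc N. pairwise disjnt (F i)"
      by (auto simp: F_def disjoint_family_on_def)
    ultimately show ?thesis
      using a by (intro exI[of _ F]) auto
  next
    case True
    then obtain b where b: "\<And>a. a \<in> A \<Longrightarrow> rad a \<le> b"
      by (auto simp: bdd_above_def)
    have "\<exists>(c :: nat \<Rightarrow> 'a) J. c ` J \<subseteq> A \<and> A \<subseteq> (\<Union>j\<in>J. mcball (c j) (rad (c j))) \<and>
      (\<forall>i\<in>J. \<forall>j\<in>J. i < j \<longrightarrow> rad (c i) < d (c i) (c j) \<and> rad (c j) \<le> 2 * rad (c i))"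
      by (rule greedy_ball_selection[OF A]) (erule rad_pos b | rule separated; assumption)+
    then obtain c :: "nat \<Rightarrow> 'a" and J where cJ: "c ` J \<subseteq> A"
      and cover: "A \<subseteq> (\<Union>j\<in>J. mcball (c j) (rad (c j)))"
      and ordered: "\<forall>i\<in>J. \<forall>j\<in>J. i < j \<longrightarrow> rad (c i) < d (c i) (c j) \<and> rad (c j) \<le> 2 * rad (c i)"
      by (elim exE conjE) (rule that)
    have cA: "c j \<in> A" if "j \<in> J" for j
      using cJ that by blast
    have order: "rad (c i) < d (c i) (c j) \<and> rad (c j) \<le> 2 * rad (c i)"
      if "i \<in> J" "j \<in> J" "i < j" for i j
      using ordered that by simp
    define B where "B j = mcball (c j) (rad (c j))" for j
    \<comment> \<open>The graph to be coloured: selected balls are adjacent when they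
      intersect.\<close>
    define R where "R i k \<longleftrightarrow> i \<in> J \<and> k \<in> J \<and> \<not> disjnt (B i) (B k)" for i k
    have "card {i. i < k \<and> R i k} \<le> N" for k
    proof (cases "k \<in> J")
      case True
      show ?thesis
      proof (rule overlap)
        show "c k \<in> M" "rad (c k) > 0" "c ` {i. i < k \<and> R i k} \<subseteq> M"
          using cA rad A True by (auto simp: R_def)
      qed (use order True in \<open>auto simp: R_def B_def\<close>)
    qed (simp add: R_def)
    then obtain col where col: "\<And>k. col k \<le> N" "\<And>i k. i < k \<Longrightarrow> R i k \<Longrightarrow> col i \<noteq> col k"
      using bounded_degree_colouring[of R N] by blast
    have disj: "disjnt (B i) (B k)" if "i \<in> J" "k \<in> J" "i \<noteq> k" "col i = col k" for i k
      using col(2)[of i k] col(2)[of k i] that unfolding R_def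
      by (metis disjnt_sym nat_neq_iff)
    \<comment> \<open>In a general metric space a ball does not determine its centre. Here equal
      balls would contain each other's centres, while a later centre avoids every earlier ball.
      Hence distinct colour classes share no ball.\<close>
    have B_eq: "i = k" if "i \<in> J" "k \<in> J" "B i = B k" for i k
    proof -
      have "c i \<in> B i" "c k \<in> B k"
        using that cA A rad by (force simp: B_def)+
      then have "c k \<in> B i" "c i \<in> B k"
        using that by auto
      then show ?thesis
        using order[of i k] order[of k i] that by (force simp: B_def)
    qed
    define F where "F m = B ` {j \<in> J. col j = m}" for m
    have F_Un: "(\<Union>i<Suc N. F i) = B ` J"
      using col(1) by (fastforce simp: F_def less_Suc_eq_le)
    show ?thesis
    proof (intro exI[of _ F] conjI)
      show "(\<Union>i<Suc N. F i) \<subseteq> \<B>"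
        unfolding F_Un using rad cA by (auto simp: B_def)
      show "A \<subseteq> \<Union>(\<Union>i<Suc N. F i)"
        unfolding F_Un using cover by (simp add: B_def)
      show "disjoint_family_on F {..<Suc N}"
        using B_eq by (auto simp: F_def disjoint_family_on_def)
      show "\<forall>i<Suc N. pairwise disjnt (F i)"
      proof (intro allI impI pairwiseI)
        fix m C D assume "C \<in> F m" "D \<in> F m" "C \<noteq> D"
        moreover from this obtain i k where "i \<in> J" "col i = m" "C = B i" "k \<in> J" "col k = m" "D = B k"
          unfolding F_def by blast
        ultimately show "disjnt C D"
          using disj[of i k] by auto
      qed
    qed
  qed
  then obtain F where F: "(\<Union>i<Suc N. F i) \<subseteq> \<B>" "A \<subseteq> \<Union>(\<Union>i<Suc N. F i)"
    "disjoint_family_on F {..<Suc N}" "\<forall>i<Suc N. pairwise disjnt (F i)"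
    by blast
  show "\<exists>\<B>'\<subseteq>\<B>. A \<subseteq> \<Union>\<B>' \<and>
        (\<forall>y\<in>M. (\<Sum>\<^sub>\<infinity>B\<in>\<B>'. indicator B y :: ennreal) \<le> of_nat (Suc N)) \<and>
        (\<exists>\<F> :: nat \<Rightarrow> 'a set set.
          \<B>' = (\<Union>i<Suc N. \<F> i) \<and> disjoint_family_on \<F> {..<Suc N} \<and>
          (\<forall>i<Suc N. pairwise disjnt (\<F> i)))"
  proof (intro exI[of _ "\<Union>i<Suc N. F i"] exI[of _ F] conjI ballI)
    fix y
    show "(\<Sum>\<^sub>\<infinity>B\<in>(\<Union>i<Suc N. F i). indicator B y :: ennreal) \<le> of_nat (Suc N)"
      using F(4) by (intro sum_indicator_le_card) auto
  qed (use F in simp_all)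
qed

end

section \<open>Inequalities for real powers\<close>

lemma powr_superadditive:
  fixes a b k :: real
  assumes "0 \<le> a" "0 \<le> b" "1 \<le> k"
  shows "a powr k + b powr k \<le> (a + b) powr k"
proof -
  have eq: "x powr k = x * x powr (k - 1)" if "0 \<le> x" for x
    using that by (simp add: powr_mult_base)
  have "a powr k \<le> a * (a + b) powr (k - 1)" "b powr k \<le> b * (a + b) powr (k - 1)"
    using assms by (auto simp: eq intro!: mult_left_mono powr_mono2)
  then show ?thesis
    using assms by (simp add: eq[of "a + b"] algebra_simps)
qed

text \<open>Differentiability is available only in the open half-line, so the boundary cases are
  separate. For \<open>b = 0\<close> the convention \<open>0 powr 0 = 0\<close> makes the slope term
  vanish even when \<open>k = 1\<close>.\<close>

lemma powr_above_tangent: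
  fixes a b k :: real
  assumes "0 \<le> a" "0 \<le> b" "1 \<le> k"
  shows "b powr k + k * b powr (k - 1) * (a - b) \<le> a powr k"
proof -
  have eq: "x powr k = x * x powr (k - 1)" if "0 \<le> x" for x
    using that by (simp add: powr_mult_base)
  consider "b = 0" | "b > 0" "a = 0" | "b > 0" "a > 0"
    using assms by linarith
  then show ?thesis
  proof cases
    case 2
    then show ?thesis
      using assms mult_right_mono[of 1 k "b * b powr (k - 1)"] by (simp add: eq algebra_simps)
  next
    case 3
    have "a powr k - b powr k \<ge> k * b powr (k - 1) * (a - b)"
    proof (rule convex_on_imp_above_tangent[where A = "{0<..}"])
      show "convex_on {0<..} (\<lambda>x. x powr k)"
        using assms by (intro powr_convex)
      show "((\<lambda>x. x powr k) has_real_derivative k * b powr (k - 1)) (at b within {0<..})"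
        using 3 by (auto intro!: derivative_eq_intros)
    qed (use 3 in \<open>auto simp: interior_open\<close>)
    then show ?thesis
      by simp
  qed auto
qed

text \<open>Average the tangent inequalities at the intermediate point: the linear terms cancel.
  This includes the endpoint 0.\<close>

lemma convex_on_powr_nonneg:
  fixes k :: real
  assumes "1 \<le> k"
  shows "convex_on {0..} (\<lambda>x. x powr k)"
proof (rule convex_onI)
  fix t x y :: real
  assume t: "0 < t" "t < 1" and xy: "x \<in> {0..}" "y \<in> {0..}"
  let ?b = "(1 - t) * x + t * y"
  have "?b powr k + k * ?b powr (k - 1) * (x - ?b) \<le> x powr k"
    "?b powr k + k * ?b powr (k - 1) * (y - ?b) \<le> y powr k"
    using t xy assms by (auto intro!: powr_above_tangent)
  then have "(1 - t) * (?b powr k + k * ?b powr (k - 1) * (x - ?b)) +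
      t * (?b powr k + k * ?b powr (k - 1) * (y - ?b)) \<le> (1 - t) * x powr k + t * y powr k"
    using t by (intro add_mono mult_left_mono) auto
  moreover have "(1 - t) * (?b powr k + k * ?b powr (k - 1) * (x - ?b)) +
      t * (?b powr k + k * ?b powr (k - 1) * (y - ?b)) = ?b powr k"
    by (simp add: algebra_simps)
  ultimately show "((1 - t) *\<^sub>R x + t *\<^sub>R y) powr k \<le> (1 - t) * x powr k + t * y powr k"
    by simp
qed simp

lemma Minkowski_pair:
  fixes a b c d p :: real
  assumes "0 \<le> a" "0 \<le> b" "0 \<le> c" "0 \<le> d" "1 \<le> p"
  shows "((a + c) powr p + (b + d) powr p) powr (1/p) \<le>
    (a powr p + b powr p) powr (1/p) + (c powr p + d powr p) powr (1/p)"
proof -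
  define \<alpha> \<beta> where "\<alpha> = (a powr p + b powr p) powr (1/p)" and "\<beta> = (c powr p + d powr p) powr (1/p)"
  have \<alpha>p: "\<alpha> powr p = a powr p + b powr p" and \<beta>p: "\<beta> powr p = c powr p + d powr p"
    using assms by (simp_all add: \<alpha>_def \<beta>_def powr_powr)
  have nn: "0 \<le> \<alpha>" "0 \<le> \<beta>"
    by (simp_all add: \<alpha>_def \<beta>_def)
  show ?thesis
  \<comment> \<open>A pair of \<open>p\<close>-norm 0 is zero and cannot be normalised.\<close>
  proof (cases "\<alpha> = 0 \<or> \<beta> = 0")
    case True
    then show ?thesis
    proof
      assume "\<alpha> = 0"
      then have "a = 0" "b = 0"
        using \<alpha>p assms by (auto simp: add_nonneg_eq_0_iff)
      then show ?thesis
        by simp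
    next
      assume "\<beta> = 0"
      then have "c = 0" "d = 0"
        using \<beta>p assms by (auto simp: add_nonneg_eq_0_iff)
      then show ?thesis
        by simp
    qed
  next
    case False
    then have pos: "\<alpha> > 0" "\<beta> > 0"
      using nn by auto
    \<comment> \<open>Weights proportional to the two \<open>p\<close>-norms turn the convex
      combination of the normalised entries \<open>x / \<alpha>\<close> and
      \<open>y / \<beta>\<close> into \<open>(x + y) / (\<alpha> + \<beta>)\<close>.\<close>
    define t where "t = \<beta> / (\<alpha> + \<beta>)"
    have t: "0 \<le> t" "t \<le> 1" "1 - t = \<alpha> / (\<alpha> + \<beta>)"
      using pos by (auto simp: t_def field_simps)
    have conv: "((x + y) / (\<alpha> + \<beta>)) powr p \<le> (1 - t) * (x powr p / \<alpha> powr p) + t * (y powr p / \<beta> powr p)"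
      if "0 \<le> x" "0 \<le> y" for x y
    proof -
      have "((1 - t) *\<^sub>R (x / \<alpha>) + t *\<^sub>R (y / \<beta>)) powr p \<le> (1 - t) * (x / \<alpha>) powr p + t * (y / \<beta>) powr p"
        using pos that t by (intro convex_onD[OF convex_on_powr_nonneg[OF assms(5)]]) auto
      moreover have "(1 - t) *\<^sub>R (x / \<alpha>) + t *\<^sub>R (y / \<beta>) = (x + y) / (\<alpha> + \<beta>)"
        using pos unfolding t(3) by (simp add: t_def add_divide_distrib)
      ultimately show ?thesis
        using pos that by (simp add: powr_divide)
    qed
    have "((a + c) / (\<alpha> + \<beta>)) powr p + ((b + d) / (\<alpha> + \<beta>)) powr p
      \<le> ((1 - t) * (a powr p / \<alpha> powr p) + t * (c powr p / \<beta> powr p))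
        + ((1 - t) * (b powr p / \<alpha> powr p) + t * (d powr p / \<beta> powr p))"
      using assms by (intro add_mono conv) auto
    also have "\<dots> = (1 - t) * ((a powr p + b powr p) / \<alpha> powr p) + t * ((c powr p + d powr p) / \<beta> powr p)"
      by (simp add: algebra_simps add_divide_distrib)
    also have "\<dots> = 1"
      unfolding \<alpha>p[symmetric] \<beta>p[symmetric] using pos by simp
    finally have "((a + c) powr p + (b + d) powr p) \<le> (\<alpha> + \<beta>) powr p"
      using pos assms by (simp add: powr_divide field_simps)
    then have "((a + c) powr p + (b + d) powr p) powr (1/p) \<le> ((\<alpha> + \<beta>) powr p) powr (1/p)"
      using assms by (intro powr_mono2) auto
    also have "\<dots> = \<alpha> + \<beta>"
      using assms pos by (simp add: powr_powr)
    finally show ?thesis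
      by (simp add: \<alpha>_def \<beta>_def)
  qed
qed

lemma norm_diff_of_close_directions:
  fixes x y :: "'a::real_inner"
  assumes "dist (sgn x) (sgn y) \<le> 1/2" "norm y \<le> norm x"
  shows "norm (x - y) \<le> norm x - norm y / 2"
proof -
  have eq: "norm v *\<^sub>R sgn v = v" for v :: 'a
    by (cases "v = 0") (auto simp: sgn_div_norm)
  \<comment> \<open>First change the length along the direction of \<open>x\<close>, then turn to
    the direction of \<open>y\<close> at length \<open>norm y\<close>.\<close>
  have "x - y = (norm x - norm y) *\<^sub>R sgn x + norm y *\<^sub>R (sgn x - sgn y)"
    by (simp add: eq algebra_simps)
  then have "norm (x - y) \<le> norm ((norm x - norm y) *\<^sub>R sgn x) + norm (norm y *\<^sub>R (sgn x - sgn y))"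
    using norm_triangle_ineq by metis
  also have "\<dots> \<le> (norm x - norm y) * 1 + norm y * (1/2)"
    unfolding norm_scaleR
    using assms by (intro add_mono mult_mono) (auto simp: norm_sgn dist_norm)
  finally show ?thesis
    by simp
qed

section \<open>The parabolic norm\<close>

text \<open>The root on the second coordinate makes this the planar \<open>p\<close>-norm of two
  quantities that both scale linearly under \<open>dilation\<close>.\<close>

definition parabolic_norm :: "real \<Rightarrow> (real ^ 'n) \<times> real \<Rightarrow> real" where
  "parabolic_norm p u = (norm (fst u) powr p + sqrt \<bar>snd u\<bar> powr p) powr (1 / p)"

definition dilation :: "real \<Rightarrow> (real ^ 'n) \<times> real \<Rightarrow> (real ^ 'n) \<times> real" where
  "dilation l u = (l *\<^sub>R fst u, l\<^sup>2 * snd u)"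

lemma sqrt_powr: "0 \<le> t \<Longrightarrow> sqrt t powr p = t powr (p / 2)"
  by (simp add: powr_half_sqrt[symmetric] powr_powr)

lemma parabolic_dist_eq_norm: "parabolic_dist p u v = parabolic_norm p (u - v)"
  by (simp add: parabolic_dist_def parabolic_norm_def split_beta sqrt_powr)

lemma parabolic_norm_nonneg [simp]: "0 \<le> parabolic_norm p u"
  by (simp add: parabolic_norm_def)

lemma parabolic_norm_minus_commute: "parabolic_norm p (u - v) = parabolic_norm p (v - u)"
  by (simp add: parabolic_norm_def norm_minus_commute abs_minus_commute)

lemma dilation_diff: "dilation l (u - v) = dilation l u - dilation l v"
  by (simp add: dilation_def algebra_simps)

context
  fixes p :: real
  assumes p: "2 \<le> p"
begin

lemma parabolic_norm_powr:
  "parabolic_norm p u powr p = norm (fst u) powr p + sqrt \<bar>snd u\<bar> powr p"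
  using p by (simp add: parabolic_norm_def powr_powr)

lemma parabolic_norm_le_iff:
  "parabolic_norm p u \<le> parabolic_norm p v \<longleftrightarrow>
    norm (fst u) powr p + sqrt \<bar>snd u\<bar> powr p \<le> norm (fst v) powr p + sqrt \<bar>snd v\<bar> powr p"
  unfolding parabolic_norm_powr[symmetric] using p
  by (metis linorder_not_le parabolic_norm_nonneg powr_less_mono2 powr_mono2 less_le_trans zero_less_numeral less_imp_le)

lemma norm_fst_le_parabolic_norm: "norm (fst u) \<le> parabolic_norm p u"
proof -
  have "norm (fst u) = (norm (fst u) powr p) powr (1 / p)"
    using p by (simp add: powr_powr)
  also have "\<dots> \<le> parabolic_norm p u"
    unfolding parabolic_norm_def using p by (intro powr_mono2) auto
  finally show ?thesis .
qed

lemma sqrt_snd_le_parabolic_norm: "sqrt \<bar>snd u\<bar> \<le> parabolic_norm p u"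
proof -
  have "sqrt \<bar>snd u\<bar> = (sqrt \<bar>snd u\<bar> powr p) powr (1 / p)"
    using p by (simp add: powr_powr)
  also have "\<dots> \<le> parabolic_norm p u"
    unfolding parabolic_norm_def using p by (intro powr_mono2) auto
  finally show ?thesis .
qed

lemma parabolic_norm_le_add: "parabolic_norm p u \<le> norm (fst u) + sqrt \<bar>snd u\<bar>"
proof -
  have "parabolic_norm p u \<le> ((norm (fst u) + sqrt \<bar>snd u\<bar>) powr p) powr (1 / p)"
    unfolding parabolic_norm_def using p by (intro powr_mono2 powr_superadditive) auto
  then show ?thesis
    using p by (simp add: powr_powr)
qed

lemma parabolic_norm_eq_0_iff: "parabolic_norm p u = 0 \<longleftrightarrow> u = 0"
proof
  assume "parabolic_norm p u = 0"
  then show "u = 0"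
    using norm_fst_le_parabolic_norm[of u] sqrt_snd_le_parabolic_norm[of u]
    by (simp add: prod_eq_iff)
qed (simp add: parabolic_norm_def)

text \<open>Subadditivity of the square root reduces this to Minkowski's inequality for
  pairs.\<close>

lemma parabolic_norm_triangle: "parabolic_norm p (u + v) \<le> parabolic_norm p u + parabolic_norm p v"
proof -
  have "sqrt \<bar>snd (u + v)\<bar> \<le> sqrt (\<bar>snd u\<bar> + \<bar>snd v\<bar>)"
    by simp
  also have "\<dots> \<le> sqrt \<bar>snd u\<bar> + sqrt \<bar>snd v\<bar>"
    by (rule sqrt_add_le_add_sqrt) auto
  finally have "parabolic_norm p (u + v) \<le>
      ((norm (fst u) + norm (fst v)) powr p + (sqrt \<bar>snd u\<bar> + sqrt \<bar>snd v\<bar>) powr p) powr (1 / p)"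
    unfolding parabolic_norm_def using p
    by (intro powr_mono2 add_mono) (auto intro: norm_triangle_ineq)
  also have "\<dots> \<le> parabolic_norm p u + parabolic_norm p v"
    unfolding parabolic_norm_def using p by (intro Minkowski_pair) auto
  finally show ?thesis .
qed

lemma parabolic_norm_dilation:
  assumes "0 \<le> l"
  shows "parabolic_norm p (dilation l u) = l * parabolic_norm p u"
proof -
  have "parabolic_norm p (dilation l u) = (l powr p * parabolic_norm p u powr p) powr (1 / p)"
    unfolding parabolic_norm_powr using assms
    by (simp add: parabolic_norm_def dilation_def abs_mult real_sqrt_mult powr_mult algebra_simps)
  also have "\<dots> = l * parabolic_norm p u"
    using assms p by (simp add: powr_mult powr_powr)
  finally show ?thesis .
qed

lemma Metric_space_parabolic_dist:
  "Metric_space UNIV (parabolic_dist p :: (real ^ 'n) \<times> real \<Rightarrow> (real ^ 'n) \<times> real \<Rightarrow> real)"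
proof
  fix u v w :: "(real ^ 'n) \<times> real"
  show "parabolic_dist p u w \<le> parabolic_dist p u v + parabolic_dist p v w"
    using parabolic_norm_triangle[of "u - v" "v - w"] by (simp add: parabolic_dist_eq_norm)
qed (simp_all add: parabolic_dist_eq_norm parabolic_norm_eq_0_iff parabolic_norm_minus_commute)

end

section \<open>Separated sets in parabolic balls\<close>

lemma bounded_finite_net:
  fixes E :: "'a::heine_borel set"
  assumes "bounded E" "e > 0"
  obtains F where "finite F" "E \<subseteq> (\<Union>x\<in>F. ball x e)"
proof -
  have "compact (closure E)"
    using assms by (simp add: compact_closure)
  then obtain F where "finite F" "closure E \<subseteq> (\<Union>x\<in>F. ball x e)"
    using assms(2) unfolding compact_eq_totally_bounded by blast
  then show thesis
    using that closure_subset by (meson order_trans)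
qed

text \<open>Parabolic balls are Euclidean bounded, and Euclidean closeness forces parabolic
  closeness. So the size of one finite Euclidean net bounds all separated sets at once.\<close>

lemma parabolic_separated_bound:
  fixes \<rho> \<epsilon> p :: real
  assumes p: "2 \<le> p" and "\<epsilon> > 0"
  obtains N where "\<And>S :: ((real ^ 'n) \<times> real) set.
    \<lbrakk>\<And>u. u \<in> S \<Longrightarrow> parabolic_norm p u \<le> \<rho>; pairwise (\<lambda>u v. \<epsilon> \<le> parabolic_norm p (u - v)) S\<rbrakk>
    \<Longrightarrow> finite S \<and> card S \<le> N"
proof -
  let ?E = "{u :: (real ^ 'n) \<times> real. parabolic_norm p u \<le> \<rho>}"
  \<comment> \<open>Chosen so that each of the two terms in
    \<open>norm (fst u) + sqrt \<bar>snd u\<bar>\<close> stays below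
    \<open>\<epsilon> / 2\<close>.\<close>
  define \<delta> where "\<delta> = min (\<epsilon> / 2) ((\<epsilon> / 2)\<^sup>2)"
  have "\<delta> > 0"
    using assms by (simp add: \<delta>_def)
  have small: "parabolic_norm p u < \<epsilon>" if "norm u < \<delta>" for u :: "(real ^ 'n) \<times> real"
  proof -
    have "norm (fst u) < \<epsilon> / 2" "\<bar>snd u\<bar> < (\<epsilon> / 2)\<^sup>2"
      using that norm_fst_le[of "fst u" "snd u"] norm_snd_le[of "snd u" "fst u"] by (auto simp: \<delta>_def)
    moreover from this(2) have "sqrt \<bar>snd u\<bar> < \<epsilon> / 2"
      using assms by (intro real_less_lsqrt) auto
    ultimately show ?thesis
      using parabolic_norm_le_add[OF p, of u] by simp
  qed
  have "bounded ?E"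
  proof (rule boundedI)
    fix u :: "(real ^ 'n) \<times> real" assume "u \<in> ?E"
    then have "norm (fst u) \<le> \<rho>" "sqrt \<bar>snd u\<bar> \<le> \<rho>"
      using norm_fst_le_parabolic_norm[OF p, of u] sqrt_snd_le_parabolic_norm[OF p, of u] by auto
    moreover from this(2) have "\<bar>snd u\<bar> \<le> \<rho>\<^sup>2"
      by (rule sqrt_le_D)
    moreover have "norm u \<le> norm (fst u) + norm (snd u)"
      using norm_Pair_le[of "fst u" "snd u"] by simp
    ultimately show "norm u \<le> \<rho> + \<rho>\<^sup>2"
      by simp
  qed
  then obtain F where F: "finite F" "?E \<subseteq> (\<Union>x\<in>F. ball x (\<delta> / 2))"
    using bounded_finite_net[of ?E "\<delta> / 2"] \<open>\<delta> > 0\<close> by auto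
  have "finite S \<and> card S \<le> card F"
    if S: "\<And>u. u \<in> S \<Longrightarrow> parabolic_norm p u \<le> \<rho>"
      "pairwise (\<lambda>u v. \<epsilon> \<le> parabolic_norm p (u - v)) S" for S :: "((real ^ 'n) \<times> real) set"
  proof -
    have "\<exists>x\<in>F. dist x u < \<delta> / 2" if "u \<in> S" for u
      using subsetD[OF F(2), of u] S(1)[OF that] by simp
    then obtain f where f: "\<And>u. u \<in> S \<Longrightarrow> f u \<in> F \<and> dist (f u) u < \<delta> / 2"
      by metis
    have inj: "inj_on f S"
    proof (rule inj_onI, rule ccontr)
      fix u v assume uv: "u \<in> S" "v \<in> S" "f u = f v" "u \<noteq> v"
      then have "dist u v < \<delta>"
        using f[of u] f[of v] by (metis dist_triangle_half_r)
      then have "parabolic_norm p (u - v) < \<epsilon>"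
        by (intro small) (simp add: dist_norm)
      then show False
        using pairwiseD[OF S(2) uv(1,2,4)] by simp
    qed
    have "f ` S \<subseteq> F"
      using f by auto
    then show ?thesis
      using card_inj_on_le[OF inj] inj_on_finite[OF inj] F(1) by simp
  qed
  then show thesis
    using that by blast
qed

section \<open>Comparing distances to a near centre and to the unit ball\<close>

text \<open>With \<open>k = p / 2\<close>, the next two lemmas compare \<open>d\<^sub>p((x, t), (y, s))\<close> with \<open>d\<^sub>p((x, t), (z, q))\<close>,
  where \<open>(z, q)\<close> is in the unit ball. In the horizontal case the gain in the first summand has order
  \<open>|x|\<^sup>p\<^sup>-\<^sup>1 |y|\<close> and the loss in the second one has order \<open>|x|\<^sup>p\<^sup>-\<^sup>2 |y|\<^sup>2\<close>.\<close>

lemma diff_bound_horizontal: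
  fixes x y z :: "'a::real_inner" and t s q k :: real
  assumes "1 \<le> k" "dist (sgn x) (sgn y) \<le> 1/2"
    and "norm z \<le> 1" "\<bar>q\<bar> \<le> 1" "\<bar>t\<bar> \<le> (norm x)\<^sup>2" "\<bar>s\<bar> \<le> (norm y)\<^sup>2"
    and "4 \<le> norm y" and far: "8 * 16 powr (k - 1) * norm y \<le> norm x"
  shows "(norm (x - y))\<^sup>2 powr k + \<bar>t - s\<bar> powr k \<le> (norm (x - z))\<^sup>2 powr k + \<bar>t - q\<bar> powr k"
proof -
  \<comment> \<open>\<open>h\<close> bounds the vertical loss: \<open>\<bar>t - s\<bar>\<close>
    exceeds \<open>T\<close> by at most \<open>1 + Y\<^sup>2\<close>, hence by at most
    \<open>h\<close>.\<close>
  define X Y T h where "X = norm x" and "Y = norm y" and "T = \<bar>t - q\<bar>" and "h = 2 * Y\<^sup>2"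
  \<comment> \<open>\<open>a1\<close> bounds the squared horizontal distance to \<open>y\<close>
    from above, \<open>a2\<close> the one to \<open>z\<close> from below; \<open>a2 - a1\<close> is
    the horizontal gain.\<close>
  define a1 a2 where "a1 = (X - Y / 2)\<^sup>2" and "a2 = (X - 1)\<^sup>2"
  have Y: "4 \<le> Y"
    using assms by (simp add: Y_def)
  have "1 \<le> 16 powr (k - 1)"
    using assms by (intro ge_one_powr_ge_zero) auto
  then have "8 * 1 * Y \<le> 8 * 16 powr (k - 1) * Y"
    using Y by (intro mult_right_mono mult_left_mono) auto
  then have XY: "8 * Y \<le> X"
    using far by (simp add: X_def Y_def)
  have "norm (x - y) \<le> X - Y / 2"
    unfolding X_def Y_def using assms XY Y
    by (intro norm_diff_of_close_directions) (auto simp: X_def Y_def)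
  then have xy: "(norm (x - y))\<^sup>2 \<le> a1"
    by (simp add: a1_def power_mono)
  have "X - 1 \<le> norm (x - z)"
    using norm_triangle_ineq2[of x z] assms by (simp add: X_def)
  then have xz: "a2 \<le> (norm (x - z))\<^sup>2"
    using XY Y by (simp add: a2_def power_mono)
  have Y2: "16 \<le> Y\<^sup>2"
    using power_mono[OF Y, of 2] by simp
  have ts: "\<bar>t - s\<bar> \<le> T + h"
    using assms Y2 by (simp add: T_def h_def Y_def)
  have "T + h \<le> X\<^sup>2 + 1 + 2 * Y\<^sup>2"
    using assms by (simp add: T_def h_def X_def)
  also have "\<dots> \<le> X\<^sup>2 + 3 * Y\<^sup>2"
    using Y2 by simp
  also have "Y\<^sup>2 \<le> X\<^sup>2"
    using XY Y by (intro power_mono) auto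
  finally have Th: "T + h \<le> 4 * X\<^sup>2"
    by simp
  have "(X / 2)\<^sup>2 \<le> a1"
    unfolding a1_def using XY Y by (intro power_mono) auto
  then have "T + h \<le> 16 * a1"
    using Th by (simp add: power_divide)
  then have "(T + h) powr (k - 1) \<le> (16 * a1) powr (k - 1)"
    using assms by (intro powr_mono2) (auto simp: T_def h_def)
  also have "\<dots> = 16 powr (k - 1) * a1 powr (k - 1)"
    by (simp add: powr_mult a1_def)
  finally have "(T + h) powr (k - 1) * h \<le> 16 powr (k - 1) * a1 powr (k - 1) * h"
    by (rule mult_right_mono) (simp add: h_def)
  also have "\<dots> = a1 powr (k - 1) * (16 powr (k - 1) * h)"
    by (simp only: mult_ac)
  also have "16 powr (k - 1) * h \<le> a2 - a1"
  proof -
    have "16 powr (k - 1) * h = (8 * 16 powr (k - 1) * Y) * (Y / 4)"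
      by (simp add: h_def power2_eq_square)
    also have "\<dots> \<le> X * (Y / 4)"
      using far Y by (intro mult_right_mono) (auto simp: X_def Y_def)
    also have "\<dots> \<le> (2 * X - 1 - Y / 2) * (Y / 2 - 1)"
      using XY Y by (intro mult_mono) auto
    also have "\<dots> = a2 - a1"
      by (simp add: a1_def a2_def power2_eq_square algebra_simps)
    finally show ?thesis .
  qed
  finally have key: "(T + h) powr (k - 1) * h \<le> a1 powr (k - 1) * (a2 - a1)"
    by (simp add: mult_left_mono)
  have "(norm (x - y))\<^sup>2 powr k + \<bar>t - s\<bar> powr k \<le> a1 powr k + (T + h) powr k"
    using assms xy ts by (intro add_mono powr_mono2) auto
  also have "\<dots> \<le> a2 powr k + T powr k"
  \<comment> \<open>Tangents at \<open>a1\<close> and at \<open>T + h\<close> bound the gain from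
    below and the loss from above; \<open>key\<close> compares their linear terms.\<close>
  proof -
    have "a1 powr k + k * a1 powr (k - 1) * (a2 - a1) \<le> a2 powr k"
      using assms by (intro powr_above_tangent) (auto simp: a1_def a2_def)
    moreover have "(T + h) powr k + k * (T + h) powr (k - 1) * (T - (T + h)) \<le> T powr k"
      using assms by (intro powr_above_tangent) (auto simp: T_def h_def)
    moreover have "k * ((T + h) powr (k - 1) * h) \<le> k * (a1 powr (k - 1) * (a2 - a1))"
      using key assms by (intro mult_left_mono) auto
    ultimately show ?thesis
      by (simp add: algebra_simps)
  qed
  also have "\<dots> \<le> (norm (x - z))\<^sup>2 powr k + \<bar>t - q\<bar> powr k"
    using assms xz unfolding T_def by (intro add_mono powr_mono2) (auto simp: a2_def)
  finally show ?thesis .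
qed

lemma diff_bound_vertical:
  fixes x y z :: "'a::real_inner" and t s q k :: real
  assumes "1 \<le> k" "dist (sgn x) (sgn y) \<le> 1/2"
    and "norm z \<le> 1" "\<bar>q\<bar> \<le> 1" "(norm y)\<^sup>2 \<le> \<bar>s\<bar>"
    and "17 \<le> \<bar>s\<bar>" "\<bar>s\<bar> \<le> \<bar>t\<bar>" "0 \<le> t \<longleftrightarrow> 0 \<le> s" "norm x \<le> 2 \<longleftrightarrow> norm y \<le> 2"
  shows "(norm (x - y))\<^sup>2 powr k + \<bar>t - s\<bar> powr k \<le> (norm (x - z))\<^sup>2 powr k + \<bar>t - q\<bar> powr k"
proof -
  have ts: "\<bar>t - s\<bar> = \<bar>t\<bar> - \<bar>s\<bar>"
    using assms by auto
  have tq: "\<bar>t\<bar> - 1 \<le> \<bar>t - q\<bar>"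
    using assms by auto
  show ?thesis
  proof (cases "norm y \<le> norm x \<and> 2 < norm y")
    \<comment> \<open>Here \<open>norm y / 2\<close> exceeds 1, so \<open>y\<close> beats
      \<open>z\<close> in each coordinate separately.\<close>
    case True
    have "norm (x - y) \<le> norm x - norm y / 2"
      using True assms by (intro norm_diff_of_close_directions) auto
    moreover have "norm x - 1 \<le> norm (x - z)"
      using norm_triangle_ineq2[of x z] assms by simp
    ultimately have "norm (x - y) \<le> norm (x - z)"
      using True by linarith
    then show ?thesis
      using assms ts tq by (intro add_mono powr_mono2 power_mono) auto
  next
    case False
    \<comment> \<open>The vertical gain is at least \<open>\<bar>s\<bar> - 1\<close>, so
      superadditivity absorbs a squared horizontal displacement of this size. Near the axis the
      displacement is at most 4, which is why \<open>\<bar>s\<bar>\<close> must be at least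
      \<open>17 = 4\<^sup>2 + 1\<close>.\<close>
    have "(norm (x - y))\<^sup>2 \<le> \<bar>s\<bar> - 1"
    proof (cases "norm y \<le> 2")
      case True
      then have "norm (x - y) \<le> 4"
        using norm_triangle_ineq4[of x y] assms by simp
      then have "(norm (x - y))\<^sup>2 \<le> 4\<^sup>2"
        by (intro power_mono) auto
      then show ?thesis
        using assms by simp
    next
      case 2: False
      then have "norm (y - x) \<le> norm y - norm x / 2"
        using False assms by (intro norm_diff_of_close_directions) (auto simp: dist_commute)
      then have "norm (x - y) \<le> norm y - 1"
        using 2 assms by (simp add: norm_minus_commute)
      then have "(norm (x - y))\<^sup>2 \<le> (norm y - 1)\<^sup>2"
        by (intro power_mono) auto
      also have "\<dots> \<le> (norm y)\<^sup>2 - 1"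
        using 2 by (simp add: power2_eq_square algebra_simps)
      finally show ?thesis
        using assms by simp
    qed
    then have "(norm (x - y))\<^sup>2 powr k + \<bar>t - s\<bar> powr k \<le> (\<bar>s\<bar> - 1) powr k + (\<bar>t\<bar> - \<bar>s\<bar>) powr k"
      using assms ts by (intro add_mono powr_mono2) auto
    also have "\<dots> \<le> (\<bar>s\<bar> - 1 + (\<bar>t\<bar> - \<bar>s\<bar>)) powr k"
      using assms by (intro powr_superadditive) auto
    also have "\<dots> \<le> \<bar>t - q\<bar> powr k"
      using assms tq by (intro powr_mono2) auto
    finally show ?thesis
      by (simp add: add_increasing)
  qed
qed

text \<open>The dominant coordinate carries at least half of the parabolic norm, and it is the same
  one for \<open>u\<close> and \<open>v\<close>. The size hypotheses thus pass to that coordinate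
  with a loss of a factor 2, and the vertical or the horizontal comparison applies.\<close>

lemma parabolic_norm_diff_le:
  fixes u v w :: "(real ^ 'n) \<times> real"
  assumes p: "2 \<le> p"
    and dir: "dist (sgn (fst u)) (sgn (fst v)) \<le> 1/2"
    and sign: "0 \<le> snd u \<longleftrightarrow> 0 \<le> snd v"
    and steep: "(norm (fst u))\<^sup>2 \<le> \<bar>snd u\<bar> \<longleftrightarrow> (norm (fst v))\<^sup>2 \<le> \<bar>snd v\<bar>"
    and near: "norm (fst u) \<le> 2 \<longleftrightarrow> norm (fst v) \<le> 2"
    and w: "parabolic_norm p w \<le> 1"
    and v: "16 powr (p / 2) \<le> parabolic_norm p v"
    and u: "16 powr (p / 2) * parabolic_norm p v \<le> parabolic_norm p u"
  shows "parabolic_norm p (u - v) \<le> parabolic_norm p (u - w)"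
proof -
  define k where "k = p / 2"
  have k: "1 \<le> k"
    using p by (simp add: k_def)
  have K: "16 powr k = 16 * 16 powr (k - 1)" "16 \<le> 16 powr k"
    using k powr_mono[of 1 k 16] by (simp_all add: powr_mult_base)
  have w': "norm (fst w) \<le> 1" "\<bar>snd w\<bar> \<le> 1"
    using norm_fst_le_parabolic_norm[OF p, of w] sqrt_snd_le_parabolic_norm[OF p, of w] w
      order_trans[of "sqrt \<bar>snd w\<bar>" _ 1] by auto
  have "(norm (fst u - fst v))\<^sup>2 powr k + \<bar>snd u - snd v\<bar> powr k \<le>
      (norm (fst u - fst w))\<^sup>2 powr k + \<bar>snd u - snd w\<bar> powr k"
  proof (cases "(norm (fst u))\<^sup>2 \<le> \<bar>snd u\<bar>")
    case True
    have le: "parabolic_norm p z \<le> 2 * sqrt \<bar>snd z\<bar>" if "(norm (fst z))\<^sup>2 \<le> \<bar>snd z\<bar>" for z :: "(real ^ 'n) \<times> real"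
      using parabolic_norm_le_add[OF p, of z] real_le_rsqrt[OF that] by simp
    have "16 \<le> 2 * sqrt \<bar>snd v\<bar>"
      using le[of v] v K True steep by (simp add: k_def)
    then have "8\<^sup>2 \<le> (sqrt \<bar>snd v\<bar>)\<^sup>2"
      by (intro power_mono) auto
    then have s: "17 \<le> \<bar>snd v\<bar>"
      by simp
    have "16 * sqrt \<bar>snd v\<bar> \<le> 16 powr (p / 2) * parabolic_norm p v"
      using K sqrt_snd_le_parabolic_norm[OF p, of v] by (intro mult_mono) (auto simp: k_def)
    then have "16 * sqrt \<bar>snd v\<bar> \<le> 2 * sqrt \<bar>snd u\<bar>"
      using le[OF True] u by linarith
    then have "sqrt \<bar>snd v\<bar> \<le> sqrt \<bar>snd u\<bar>"
      using real_sqrt_ge_zero[of "\<bar>snd v\<bar>"] by linarith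
    then show ?thesis
      using True k s w' dir sign steep near by (intro diff_bound_vertical) auto
  next
    case False
    have le: "parabolic_norm p z \<le> 2 * norm (fst z)" if "\<not> (norm (fst z))\<^sup>2 \<le> \<bar>snd z\<bar>" for z :: "(real ^ 'n) \<times> real"
      using parabolic_norm_le_add[OF p, of z] real_le_lsqrt[of "norm (fst z)" "\<bar>snd z\<bar>"] that by simp
    have y: "4 \<le> norm (fst v)"
      using le[of v] v K False steep by (simp add: k_def)
    have "16 powr k * norm (fst v) \<le> 16 powr k * parabolic_norm p v"
      using norm_fst_le_parabolic_norm[OF p, of v] by (intro mult_left_mono) auto
    then have "8 * 16 powr (k - 1) * norm (fst v) \<le> norm (fst u)"
      using le[OF False] u unfolding k_def[symmetric] K(1) by linarith
    then show ?thesis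
      using False k y w' dir steep by (intro diff_bound_horizontal) auto
  qed
  moreover have "a powr p = a\<^sup>2 powr k" if "0 \<le> a" for a :: real
    using that by (simp add: k_def powr_powr flip: powr_numeral)
  ultimately show ?thesis
    unfolding parabolic_norm_le_iff[OF p] by simp
qed

section \<open>Overlap of parabolic balls\<close>

text \<open>Assign to each vector a point of a finite 1/4-net near its direction. Using
  \<open>sgn\<close> puts the zero vector into this scheme as well.\<close>

lemma finite_direction_classes:
  obtains \<phi> :: "'a::euclidean_space \<Rightarrow> 'a" where
    "finite (range \<phi>)" "\<And>x y. \<phi> x = \<phi> y \<Longrightarrow> dist (sgn x) (sgn y) \<le> 1/2"
proof -
  obtain F :: "'a set" where F: "finite F" "cball 0 1 \<subseteq> (\<Union>x\<in>F. ball x (1/4))"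
    using bounded_finite_net[of "cball 0 1 :: 'a set" "1/4"] by auto
  have "\<exists>z\<in>F. dist z (sgn x) < 1/4" for x :: 'a
  proof -
    have "sgn x \<in> cball 0 1"
      by (simp add: norm_sgn)
    then show ?thesis
      using subsetD[OF F(2), of "sgn x"] by simp
  qed
  then obtain \<phi> where \<phi>: "\<And>x. \<phi> x \<in> F \<and> dist (\<phi> x) (sgn x) < 1/4"
    by metis
  show thesis
  proof
    show "finite (range \<phi>)"
      using \<phi> F(1) by (meson finite_subset image_subsetI)
    show "dist (sgn x) (sgn y) \<le> 1/2" if "\<phi> x = \<phi> y" for x y
      using \<phi>[of x] \<phi>[of y] that dist_triangle3[of "sgn x" "sgn y" "\<phi> x"] by simp
  qed
qed

text \<open>Centres of norm at most \<open>K\<close> are counted at once; the remaining ones are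
  counted class by class after rescaling.\<close>

lemma parabolic_unit_ball_overlap:
  fixes p :: real
  assumes p: "2 \<le> p"
  obtains N where "\<And>(I :: nat set) (c :: nat \<Rightarrow> (real ^ 'n) \<times> real) r.
    \<lbrakk>finite I;
     \<And>i. i \<in> I \<Longrightarrow> 1 \<le> 2 * r i \<and> r i < parabolic_norm p (c i) \<and>
       (\<exists>w. parabolic_norm p w \<le> 1 \<and> parabolic_norm p (c i - w) \<le> r i);
     \<And>i j. \<lbrakk>i \<in> I; j \<in> I; i < j\<rbrakk> \<Longrightarrow> r i < parabolic_norm p (c i - c j) \<and> r j \<le> 2 * r i\<rbrakk>
    \<Longrightarrow> card I \<le> N"
proof -
  define K :: real where "K = 16 powr (p / 2)"
  have K: "16 \<le> K"
    using powr_mono[of 1 "p / 2" 16] p by (simp add: K_def)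
  obtain N where N: "\<And>S :: ((real ^ 'n) \<times> real) set.
    \<lbrakk>\<And>u. u \<in> S \<Longrightarrow> parabolic_norm p u \<le> K; pairwise (\<lambda>u v. 1/2 \<le> parabolic_norm p (u - v)) S\<rbrakk>
    \<Longrightarrow> finite S \<and> card S \<le> N"
    using parabolic_separated_bound[OF p, of "1/2" K] by auto
  obtain \<phi> :: "real ^ 'n \<Rightarrow> real ^ 'n" where \<phi>: "finite (range \<phi>)"
    "\<And>x y. \<phi> x = \<phi> y \<Longrightarrow> dist (sgn x) (sgn y) \<le> 1/2"
    by (rule finite_direction_classes) blast
  define cls where "cls u = (\<phi> (fst u), 0 \<le> snd u, (norm (fst u))\<^sup>2 \<le> \<bar>snd u\<bar>, norm (fst u) \<le> 2)"
    for u :: "(real ^ 'n) \<times> real"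
  define \<Gamma> where "\<Gamma> = range \<phi> \<times> (UNIV :: (bool \<times> bool \<times> bool) set)"
  have \<Gamma>: "finite \<Gamma>" "cls u \<in> \<Gamma>" for u
    using \<phi>(1) by (auto simp: \<Gamma>_def cls_def)
  have "card I \<le> N + card \<Gamma> * N"
    if I: "finite I"
      and ball: "\<And>i. i \<in> I \<Longrightarrow> 1 \<le> 2 * r i \<and> r i < parabolic_norm p (c i) \<and>
        (\<exists>w. parabolic_norm p w \<le> 1 \<and> parabolic_norm p (c i - w) \<le> r i)"
      and order: "\<And>i j. \<lbrakk>i \<in> I; j \<in> I; i < j\<rbrakk> \<Longrightarrow>
        r i < parabolic_norm p (c i - c j) \<and> r j \<le> 2 * r i"
    for I :: "nat set" and c :: "nat \<Rightarrow> (real ^ 'n) \<times> real" and r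
  proof -
    define n where "n i = parabolic_norm p (c i)" for i
    \<comment> \<open>The ball around \<open>c i\<close> reaches the unit ball.\<close>
    have r_ge: "n i - 1 \<le> r i" if "i \<in> I" for i
    proof -
      obtain w where "parabolic_norm p w \<le> 1" "parabolic_norm p (c i - w) \<le> r i"
        using ball \<open>i \<in> I\<close> by blast
      then show ?thesis
        using parabolic_norm_triangle[OF p, of "c i - w" w] by (simp add: n_def)
    qed
    \<comment> \<open>Earlier balls exclude later centres, so a lower bound on the scaled radii
      separates the scaled centres, and the packing bound applies.\<close>
    have scaled: "card I' \<le> N"
      if I': "I' \<subseteq> I" and l: "l > 0" and bound: "\<And>i. i \<in> I' \<Longrightarrow> l * n i \<le> K \<and> 1/2 \<le> l * r i" for I' l
    proof -
      have sep: "1/2 \<le> parabolic_norm p (dilation l (c i) - dilation l (c j))"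
        if "i \<in> I'" "j \<in> I'" "i \<noteq> j" for i j
      proof -
        have *: "1/2 \<le> l * parabolic_norm p (c i - c j)" if "i \<in> I'" "j \<in> I'" "i < j" for i j
        proof -
          have "1/2 \<le> l * r i"
            using bound that by blast
          also have "\<dots> \<le> l * parabolic_norm p (c i - c j)"
            using order[of i j] that subsetD[OF I'] l by (intro mult_left_mono) auto
          finally show ?thesis .
        qed
        have "1/2 \<le> l * parabolic_norm p (c i - c j)"
          using *[of i j] *[of j i] that parabolic_norm_minus_commute[of p "c i"]
          by (cases "i < j") auto
        then show ?thesis
          using l by (simp add: parabolic_norm_dilation[OF p] flip: dilation_diff)
      qed
      let ?f = "\<lambda>i. dilation l (c i)"
      have "card (?f ` I') \<le> N"
      proof (rule N[THEN conjunct2])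
        show "parabolic_norm p u \<le> K" if "u \<in> ?f ` I'" for u
          using that bound l by (auto simp: parabolic_norm_dilation[OF p] n_def)
        show "pairwise (\<lambda>u v. 1/2 \<le> parabolic_norm p (u - v)) (?f ` I')"
        proof (rule pairwiseI)
          fix u v assume "u \<in> ?f ` I'" "v \<in> ?f ` I'" "u \<noteq> v"
          then obtain i j where "i \<in> I'" "j \<in> I'" "i \<noteq> j" "u = ?f i" "v = ?f j"
            by auto
          then show "1/2 \<le> parabolic_norm p (u - v)"
            using sep by simp
        qed
      qed
      moreover have "inj_on ?f I'"
      proof (rule inj_onI, rule ccontr)
        fix i j assume *: "i \<in> I'" "j \<in> I'" "?f i = ?f j" "i \<noteq> j"
        then show False
          using sep[of i j] parabolic_norm_eq_0_iff[OF p, of "0 :: (real ^ 'n) \<times> real"] by simp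
      qed
      ultimately show ?thesis
        by (simp add: card_image)
    qed
    \<comment> \<open>Within a class all norms above \<open>K\<close> lie within a factor \<open>K\<close> of each other: otherwise a far
      centre \<open>c i\<close> would be closer to a near centre \<open>c j\<close> than to the point that its ball shares with
      the unit ball, so that \<open>c j\<close> would lie in that ball.\<close>
    define I0 where "I0 = {i \<in> I. n i \<le> K}"
    define I1 where "I1 \<gamma> = {i \<in> I. K < n i \<and> cls (c i) = \<gamma>}" for \<gamma>
    have "card I0 \<le> N"
      using ball by (intro scaled[of I0 1]) (fastforce simp: I0_def)+
    moreover have "card (I1 \<gamma>) \<le> N" for \<gamma>
    proof (cases "I1 \<gamma> = {}")
      case False
      have "finite (I1 \<gamma>)"
        using I by (simp add: I1_def)
      \<comment> \<open>A centre of smallest norm in the class serves as the near centre and, later,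
        as the unit of length.\<close>
      then obtain j where j: "j \<in> I1 \<gamma>" "\<And>i. i \<in> I1 \<gamma> \<Longrightarrow> n j \<le> n i"
        using ex_min_if_finite[of "n ` I1 \<gamma>"] False by (auto simp: not_less)
      have nj: "K < n j" "j \<in> I"
        using j by (auto simp: I1_def)
      have upper: "n i \<le> K * n j" if i: "i \<in> I1 \<gamma>" for i
      proof (rule ccontr)
        assume "\<not> n i \<le> K * n j"
        then have far: "K * n j < n i"
          by simp
        have "16 * n j \<le> K * n j"
          using K nj by (intro mult_right_mono) auto
        with far have far16: "16 * n j < n i"
          by simp
        have iI: "i \<in> I"
          using i by (simp add: I1_def)
        obtain w where w: "parabolic_norm p w \<le> 1" "parabolic_norm p (c i - w) \<le> r i"
          using ball iI by blast
        have "cls (c i) = cls (c j)"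
          using i j by (simp add: I1_def)
        then have "parabolic_norm p (c i - c j) \<le> parabolic_norm p (c i - w)"
          using w(1) far nj
          by (intro parabolic_norm_diff_le p \<phi>(2)) (auto simp: cls_def K_def n_def)
        \<comment> \<open>Otherwise the earlier ball around \<open>c i\<close> would contain the
          centre \<open>c j\<close>.\<close>
        then have "\<not> i < j"
          using order[of i j] w(2) iI nj by auto
        moreover have "i \<noteq> j"
          using far16 nj K by auto
        ultimately have "r i \<le> 2 * r j"
          using order[of j i] iI nj by auto
        moreover have "r j < n j"
          using ball nj by (auto simp: n_def)
        \<comment> \<open>The ball of \<open>i\<close> comes later, so
          \<open>n i - 1 \<le> r i \<le> 2 * r j < 2 * n j\<close>, against
          \<open>16 * n j < n i\<close>.\<close>
        ultimately show False
          using r_ge[OF iI] far16 nj K by simp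
      qed
      show ?thesis
      \<comment> \<open>Scaled radii are at least \<open>(n i - 1) / n j\<close>, which is at least
        1/2 because \<open>n i \<ge> n j > 16\<close>.\<close>
      proof (rule scaled[of "I1 \<gamma>" "1 / n j"])
        show "1 / n j * n i \<le> K \<and> 1/2 \<le> 1 / n j * r i" if i: "i \<in> I1 \<gamma>" for i
        proof -
          have "n i - 1 \<le> r i"
            using r_ge i by (simp add: I1_def)
          then show ?thesis
            using upper[OF i] j(2)[OF i] nj K by (simp add: field_simps)
        qed
      qed (use nj K in \<open>auto simp: I1_def\<close>)
    qed simp
    then have "card (\<Union>\<gamma>\<in>\<Gamma>. I1 \<gamma>) \<le> card \<Gamma> * N"
      using card_UN_le[OF \<Gamma>(1), of I1] sum_bounded_above[of \<Gamma> "\<lambda>\<gamma>. card (I1 \<gamma>)" N]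
      by simp
    moreover have "I = I0 \<union> (\<Union>\<gamma>\<in>\<Gamma>. I1 \<gamma>)"
      using \<Gamma>(2)[of "c i" for i] by (auto simp: I0_def I1_def not_le)
    ultimately show ?thesis
      using card_Un_le[of I0 "\<Union>\<gamma>\<in>\<Gamma>. I1 \<gamma>"] by simp
  qed
  then show thesis
    by (rule that)
qed

section \<open>The covering property of the parabolic space\<close>

theorem theorem1p2:
  fixes p :: real
  assumes "2 \<le> p"
  shows "Metric_space UNIV (parabolic_dist p :: (real ^ 'n) \<times> real \<Rightarrow> (real ^ 'n) \<times> real \<Rightarrow> real) \<and>
         Metric_space.strong_BCP UNIV
           (parabolic_dist p :: (real ^ 'n) \<times> real \<Rightarrow> (real ^ 'n) \<times> real \<Rightarrow> real)"
proof
  let ?d = "parabolic_dist p :: (real ^ 'n) \<times> real \<Rightarrow> (real ^ 'n) \<times> real \<Rightarrow> real"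
  show "Metric_space UNIV ?d"
    by (rule Metric_space_parabolic_dist[OF assms])
  then interpret Metric_space UNIV ?d .
  note d_eq = parabolic_dist_eq_norm
  obtain N where N: "\<And>(I :: nat set) (c :: nat \<Rightarrow> (real ^ 'n) \<times> real) r.
    \<lbrakk>finite I;
     \<And>i. i \<in> I \<Longrightarrow> 1 \<le> 2 * r i \<and> r i < parabolic_norm p (c i) \<and>
       (\<exists>w. parabolic_norm p w \<le> 1 \<and> parabolic_norm p (c i - w) \<le> r i);
     \<And>i j. \<lbrakk>i \<in> I; j \<in> I; i < j\<rbrakk> \<Longrightarrow> r i < parabolic_norm p (c i - c j) \<and> r j \<le> 2 * r i\<rbrakk>
    \<Longrightarrow> card I \<le> N"
    by (rule parabolic_unit_ball_overlap[OF assms]) blast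
  show strong_BCP
  proof (rule strong_BCP_criterion)
    fix S :: "((real ^ 'n) \<times> real) set" and \<epsilon> :: real
    assume S: "mbounded S" "\<epsilon> > 0" "pairwise (\<lambda>x y. \<epsilon> \<le> ?d x y) S"
    then obtain x b where "S \<subseteq> mcball x b"
      by (auto simp: mbounded_def)
    then have b: "parabolic_norm p (x - u) \<le> b" if "u \<in> S" for u
      using that by (auto simp: d_eq)
    obtain m where "\<And>T :: ((real ^ 'n) \<times> real) set.
      \<lbrakk>\<And>u. u \<in> T \<Longrightarrow> parabolic_norm p u \<le> b; pairwise (\<lambda>u v. \<epsilon> \<le> parabolic_norm p (u - v)) T\<rbrakk>
      \<Longrightarrow> finite T \<and> card T \<le> m"
      using parabolic_separated_bound[OF assms S(2), of b] by blast
    \<comment> \<open>The reflection \<open>u \<mapsto> x - u\<close> moves \<open>S\<close> into a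
      ball about the origin and preserves mutual distances.\<close>
    note m = this[of "(\<lambda>u. x - u) ` S"]
    have "finite ((\<lambda>u. x - u) ` S)"
    proof (rule m[THEN conjunct1])
      show "parabolic_norm p u \<le> b" if "u \<in> (\<lambda>u. x - u) ` S" for u
        using that b by blast
      show "pairwise (\<lambda>u v. \<epsilon> \<le> parabolic_norm p (u - v)) ((\<lambda>u. x - u) ` S)"
        using S(3) parabolic_norm_minus_commute[of p] by (force simp: pairwise_def d_eq)
    qed
    then show "finite S"
      by (rule finite_imageD) (simp add: inj_on_def)
  next
    fix I :: "nat set" and c :: "nat \<Rightarrow> (real ^ 'n) \<times> real" and r :: "nat \<Rightarrow> real" and x \<rho>
    assume I: "finite I" and \<rho>: "\<rho> > 0"
      and ball: "\<And>i. i \<in> I \<Longrightarrow> \<rho> \<le> 2 * r i \<and> r i < ?d (c i) x \<and> \<not> disjnt (mcball (c i) (r i)) (mcball x \<rho>)"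
      and order: "\<And>i j. \<lbrakk>i \<in> I; j \<in> I; i < j\<rbrakk> \<Longrightarrow> r i < ?d (c i) (c j) \<and> r j \<le> 2 * r i"
    \<comment> \<open>This map sends the ball of radius \<open>\<rho>\<close> about \<open>x\<close>
      to the unit ball at the origin and divides all distances by \<open>\<rho>\<close>.\<close>
    let ?f = "\<lambda>u. dilation (1 / \<rho>) (u - x)"
    have f: "parabolic_norm p (?f u) = ?d u x / \<rho>" "parabolic_norm p (?f u - ?f v) = ?d u v / \<rho>" for u v
      using \<rho> by (simp_all add: parabolic_norm_dilation[OF assms] d_eq flip: dilation_diff)
    show "card I \<le> N"
    proof (rule N[of I "\<lambda>i. r i / \<rho>" "\<lambda>i. ?f (c i)"])
      fix i assume i: "i \<in> I"
      then obtain v where "?d (c i) v \<le> r i" "?d x v \<le> \<rho>"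
        using ball[OF i] by (auto simp: disjnt_def)
      then have "parabolic_norm p (?f v) \<le> 1" "parabolic_norm p (?f (c i) - ?f v) \<le> r i / \<rho>"
        using \<rho> commute[of x v] by (simp_all add: f divide_right_mono)
      then show "1 \<le> 2 * (r i / \<rho>) \<and> r i / \<rho> < parabolic_norm p (?f (c i)) \<and>
         (\<exists>w. parabolic_norm p w \<le> 1 \<and> parabolic_norm p (?f (c i) - w) \<le> r i / \<rho>)"
        using ball[OF i] \<rho> by (intro conjI exI[of _ "?f v"]) (simp_all add: f(1) divide_strict_right_mono)
    next
      fix i j assume "i \<in> I" "j \<in> I" "i < j"
      then show "r i / \<rho> < parabolic_norm p (?f (c i) - ?f (c j)) \<and> r j / \<rho> \<le> 2 * (r i / \<rho>)"
        using order[of i j] \<rho> by (simp add: f(2) divide_strict_right_mono divide_right_mono)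
    qed (rule I)
  qed
qed

end
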